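(* Let $k\ge 0$ be a fixed integer and let $p_k(n)$ be the probability that a random vertex in a random unlabeled rooted plane tree of size $n$ is $k$-protected. Then, as $n\to\infty$, $$p_k(n)\sim \frac{3}{4^k+2}.$$
   Context: A tree means an unlabeled rooted plane tree (a finite rooted tree with at least one vertex in which the children of every vertex are linearly ordered), counted up to isomorphism; its size is its number of vertices. A leaf is a vertex with no children (so the root of the one-vertex tree is a leaf). A vertex is $k$-protected if at least $k$ downward steps (parent to child) are needed to reach any leaf from it. The tree is chosen uniformly among all trees of size $n$ and the vertex uniformly among its $n$ vertices; equivalently, $p_k(n)$ is the number of pairs (tree on $n$ vertices, $k$-protected vertex of it) divided by the number of pairs (tree on $n$ vertices, vertex of it). Write $a_n\sim b_n$ if $\lim_{n\to\infty} a_n/b_n=1$. *)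

theory Defs
  imports "HOL-Probability.Probability" "HOL-Library.Landau_Symbols"
begin

text \<open>
  The elements of this type are exactly the isomorphism classes of finite rooted plane trees:
  a tree is determined by the linearly ordered list of the subtrees hanging from its root.
\<close>
datatype plane_tree = Node (children: "plane_tree list")

text \<open>
  A vertex is encoded by its address: the list of child indices (counted from 0)
  leading from the root, which has address \<open>[]\<close>, down to the vertex.
\<close>
inductive_set vertex_set :: "(plane_tree \<times> nat list) set" where
  root: "(t, []) \<in> vertex_set"
| below: "i < length (children t) \<Longrightarrow> (children t ! i, v) \<in> vertex_set \<Longrightarrow> (t, i # v) \<in> vertex_set"

definition vertices :: "plane_tree \<Rightarrow> nat list set" where
  "vertices t = {v. (t, v) \<in> vertex_set}"

definition tree_size :: "plane_tree \<Rightarrow> nat" where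
  "tree_size t = card (vertices t)"

definition is_child :: "plane_tree \<Rightarrow> nat list \<Rightarrow> nat list \<Rightarrow> bool" where
  "is_child t v w \<longleftrightarrow> v \<in> vertices t \<and> w \<in> vertices t \<and> (\<exists>i. w = v @ [i])"

definition leaf :: "plane_tree \<Rightarrow> nat list \<Rightarrow> bool" where
  "leaf t v \<longleftrightarrow> v \<in> vertices t \<and> (\<nexists>w. is_child t v w)"

definition k_protected :: "nat \<Rightarrow> plane_tree \<Rightarrow> nat list \<Rightarrow> bool" where
  "k_protected k t v \<longleftrightarrow>
     v \<in> vertices t \<and> (\<forall>m w. (is_child t ^^ m) v w \<and> leaf t w \<longrightarrow> k \<le> m)"

definition trees_of_size :: "nat \<Rightarrow> plane_tree set" where
  "trees_of_size n = {t. tree_size t = n}"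

definition random_vertex :: "nat \<Rightarrow> (plane_tree \<times> nat list) pmf" where
  "random_vertex n =
     bind_pmf (pmf_of_set (trees_of_size n)) (\<lambda>t. map_pmf (Pair t) (pmf_of_set (vertices t)))"

text \<open>
  Only meaningful for \<open>n \<ge> 1\<close>; there is no tree of size 0, and \<^term>\<open>pmf_of_set {}\<close> is unspecified.
\<close>
definition protected_prob :: "nat \<Rightarrow> nat \<Rightarrow> real" where
  "protected_prob k n = measure_pmf.prob (random_vertex n) {(t, v). k_protected k t v}"

lemma vertices_Node:
  "vertices (Node ts) = insert [] (\<Union>i<length ts. Cons i ` vertices (ts ! i))"
proof (rule set_eqI)
  fix x
  show "x \<in> vertices (Node ts) \<longleftrightarrow> x \<in> insert [] (\<Union>i<length ts. Cons i ` vertices (ts ! i))"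
    unfolding vertices_def mem_Collect_eq
    by (subst vertex_set.simps) auto
qed

lemma finite_vertices: "finite (vertices t)"
  by (induction t) (auto simp: vertices_Node)

lemma vertices_nonempty: "vertices t \<noteq> {}"
  by (cases t) (simp add: vertices_Node)

lemma tree_size_Node: "tree_size (Node ts) = Suc (sum_list (map tree_size ts))"
proof -
  have "card (\<Union>i<length ts. Cons i ` vertices (ts ! i)) = (\<Sum>i<length ts. card (Cons i ` vertices (ts ! i)))"
    by (rule card_UN_disjoint) (auto simp: finite_vertices)
  also have "\<dots> = (\<Sum>i<length ts. tree_size (ts ! i))"
    by (simp add: tree_size_def card_image)
  also have "\<dots> = sum_list (map tree_size ts)"
    by (simp add: sum_list_sum_nth atLeast0LessThan)
  finally show ?thesis
    unfolding tree_size_def[of "Node ts"] vertices_Node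
    by (subst card_insert_disjoint) (auto simp: finite_vertices)
qed

lemma finite_trees_of_size: "finite (trees_of_size n)"
proof (induction n rule: less_induct)
  case (less n)
  let ?A = "\<Union>m<n. trees_of_size m"
  have pos: "tree_size t \<ge> 1" for t
    by (cases t) (simp add: tree_size_Node)
  have "trees_of_size n \<subseteq> Node ` {ts. set ts \<subseteq> ?A \<and> length ts \<le> n}"
  proof
    fix t assume t: "t \<in> trees_of_size n"
    obtain ts where ts: "t = Node ts" by (cases t)
    have n: "n = Suc (sum_list (map tree_size ts))"
      using t ts by (simp add: trees_of_size_def tree_size_Node)
    have "tree_size s < n" if "s \<in> set ts" for s
      using member_le_sum_list[of "tree_size s" "map tree_size ts"] that n by auto
    moreover have "length ts \<le> sum_list (map tree_size ts)"
      using sum_list_mono[of ts "\<lambda>_. 1" tree_size] pos by (simp add: sum_list_triv)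
    ultimately show "t \<in> Node ` {ts. set ts \<subseteq> ?A \<and> length ts \<le> n}"
      using ts n by (auto simp: trees_of_size_def)
  qed
  moreover have "finite {ts. set ts \<subseteq> ?A \<and> length ts \<le> n}"
    by (rule finite_lists_length_le) (use less in auto)
  ultimately show ?case
    by (meson finite_imageI finite_subset)
qed

lemma trees_of_size_nonempty:
  assumes "n \<ge> 1"
  shows "trees_of_size n \<noteq> {}"
proof -
  have "tree_size (Node (replicate (n - 1) (Node []))) = n"
    using assms by (simp add: tree_size_Node sum_list_replicate)
  thus ?thesis by (auto simp: trees_of_size_def)
qed

lemma protected_prob_eq_ratio:
  assumes n: "n \<ge> 1"
  shows "protected_prob k n =
    real (card {(t, v). t \<in> trees_of_size n \<and> v \<in> vertices t \<and> k_protected k t v}) /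
    real (card {(t, v). t \<in> trees_of_size n \<and> v \<in> vertices t})"
proof -
  let ?T = "trees_of_size n"
  let ?S = "Sigma ?T vertices"
  have fin: "finite ?S"
    by (intro finite_SigmaI finite_trees_of_size finite_vertices)
  have card_S: "card ?S = card ?T * n"
    using finite_trees_of_size
    by (simp add: finite_vertices trees_of_size_def flip: tree_size_def)
  have ne: "?S \<noteq> {}"
    using trees_of_size_nonempty[OF n] vertices_nonempty by auto
  have "random_vertex n = pmf_of_set ?S"
  proof (rule pmf_eqI)
    fix x :: "plane_tree \<times> nat list"
    obtain t v where x: "x = (t, v)" by (cases x)
    have inner: "pmf (map_pmf (Pair s) (pmf_of_set (vertices s))) (t, v) =
        (if s = t \<and> v \<in> vertices t then 1 / n else 0)" if s: "s \<in> ?T" for s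
    proof (cases "s = t")
      case True
      have "pmf (map_pmf (Pair t) (pmf_of_set (vertices t))) (t, v) = pmf (pmf_of_set (vertices t)) v"
        by (rule pmf_map_inj') (auto simp: inj_on_def)
      thus ?thesis using True s
        by (auto simp: finite_vertices vertices_nonempty indicator_def trees_of_size_def tree_size_def)
    next
      case False
      thus ?thesis by (auto simp: pmf_eq_0_set_pmf)
    qed
    have "pmf (random_vertex n) (t, v) =
        (\<Sum>s\<in>?T. pmf (map_pmf (Pair s) (pmf_of_set (vertices s))) (t, v)) / card ?T"
      unfolding random_vertex_def
      by (rule pmf_bind_pmf_of_set[OF trees_of_size_nonempty[OF n] finite_trees_of_size])
    also have "\<dots> = (\<Sum>s\<in>?T. if s = t then (if v \<in> vertices t then 1 / n else 0) else 0) / card ?T"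
      by (intro arg_cong2[where f = "(/)"] sum.cong refl) (auto simp: inner)
    also have "\<dots> = pmf (pmf_of_set ?S) (t, v)"
      using fin ne by (auto simp: finite_trees_of_size card_S sum.delta' indicator_def)
    finally show "pmf (random_vertex n) x = pmf (pmf_of_set ?S) x"
      by (simp add: x)
  qed
  moreover have "?S = {(t, v). t \<in> ?T \<and> v \<in> vertices t}" by auto
  moreover have "?S \<inter> {(t, v). k_protected k t v} =
      {(t, v). t \<in> ?T \<and> v \<in> vertices t \<and> k_protected k t v}" by auto
  ultimately show ?thesis
    unfolding protected_prob_def using measure_pmf_of_set[OF ne fin] by simp
qed

end

theory Submission
  imports Defs "HOL-Computational_Algebra.Formal_Power_Series" "HOL-Real_Asymp.Real_Asymp"
begin

text \<open>
  Let \<open>A\<^sub>k\<close> be the generating function of the trees whose root is \<open>k\<close>-protected and let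
  \<open>G = A\<^sub>0\<close>. Cutting out the subtree at a marked vertex shows that the pairs
  (tree, \<open>k\<close>-protected vertex) have generating function \<open>A\<^sub>k (1 + G') / 2\<close>, because
  \<open>G = x + G\<^sup>2\<close>. The coefficients of \<open>G'\<close> are the central binomial coefficients, for which the
  ratio of consecutive terms tends to \<open>4\<close>. So the probability, a weighted sum of the coefficients
  of \<open>A\<^sub>k\<close>, tends to \<open>2 A\<^sub>k(1/4)\<close>. Interchanging limit and sum at the singularity \<open>1/4\<close> costs
  nothing: for \<open>k = 0\<close> both sides are \<open>1\<close>, and \<open>A\<^sub>k\<close> is dominated by \<open>A\<^sub>0\<close>. Finally
  \<open>A\<^sub>k\<^sub>+\<^sub>1 = x A\<^sub>k / (1 - A\<^sub>k)\<close> with \<open>A\<^sub>0(1/4) = 1/2\<close> gives \<open>A\<^sub>k(1/4) = 3 / (2 (4\<^sup>k + 2))\<close>.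
\<close>

section \<open>Recursive structure of protected vertices\<close>

lemma Nil_in_vertices [simp]: "[] \<in> vertices t"
  by (cases t) (simp add: vertices_Node)

lemma Cons_in_vertices_Node [simp]:
  "i # v \<in> vertices (Node ts) \<longleftrightarrow> i < length ts \<and> v \<in> vertices (ts ! i)"
  by (auto simp: vertices_Node)

lemma is_child_Nil [simp]: "is_child (Node ts) [] w \<longleftrightarrow> (\<exists>i<length ts. w = [i])"
  by (auto simp: is_child_def)

lemma is_child_Cons [simp]:
  "is_child (Node ts) (i # v) w \<longleftrightarrow> i < length ts \<and> (\<exists>w'. w = i # w' \<and> is_child (ts ! i) v w')"
  by (auto simp: is_child_def)

lemma leaf_Nil [simp]: "leaf (Node ts) [] \<longleftrightarrow> ts = []"
  by (auto simp: leaf_def)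

lemma leaf_Cons [simp]: "leaf (Node ts) (i # v) \<longleftrightarrow> i < length ts \<and> leaf (ts ! i) v"
  by (auto simp: leaf_def)

text \<open>A step to a child only appends to the address, so a descent that starts inside a subtree
  never leaves it.\<close>

lemma relpowp_is_child_Cons:
  assumes "i < length ts"
  shows "(is_child (Node ts) ^^ m) (i # v) w \<longleftrightarrow> (\<exists>w'. w = i # w' \<and> (is_child (ts ! i) ^^ m) v w')"
proof (induction m arbitrary: w)
  case (Suc m)
  show ?case using assms by (auto simp: Suc relcompp_apply) blast
qed auto

lemma k_protected_Cons [simp]:
  "k_protected k (Node ts) (i # v) \<longleftrightarrow> i < length ts \<and> k_protected k (ts ! i) v"
  by (auto simp: k_protected_def relpowp_is_child_Cons) (metis leaf_Cons)+

lemma k_protected_0 [simp]: "k_protected 0 t v \<longleftrightarrow> v \<in> vertices t"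
  by (simp add: k_protected_def)

lemma k_protected_Suc_root:
  "k_protected (Suc k) (Node ts) [] \<longleftrightarrow> ts \<noteq> [] \<and> (\<forall>t\<in>set ts. k_protected k t [])"
proof -
  \<comment> \<open>Peeling off the first step leaves a descent of length \<open>m\<close> inside
    one child. Length \<open>0\<close> is treated apart below: it says that the root is no
    leaf.\<close>
  have steps: "(is_child (Node ts) ^^ Suc m) [] w \<longleftrightarrow>
      (\<exists>i<length ts. \<exists>w'. w = i # w' \<and> (is_child (ts ! i) ^^ m) [] w')" for m w
    by (auto simp: relpowp_Suc_left relcompp_apply relpowp_is_child_Cons simp del: relpowp.simps)
  have "k_protected (Suc k) (Node ts) [] \<longleftrightarrow>
      (\<forall>w. (is_child (Node ts) ^^ 0) [] w \<and> leaf (Node ts) w \<longrightarrow> Suc k \<le> 0) \<and>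
      (\<forall>m w. (is_child (Node ts) ^^ Suc m) [] w \<and> leaf (Node ts) w \<longrightarrow> Suc k \<le> Suc m)"
    unfolding k_protected_def by (metis Nil_in_vertices nat.exhaust)
  also have "\<dots> \<longleftrightarrow> ts \<noteq> [] \<and> (\<forall>i<length ts. k_protected k (ts ! i) [])"
    unfolding steps by (auto simp: k_protected_def) (metis leaf_Cons)+
  finally show ?thesis by (simp add: all_set_conv_all_nth)
qed

definition num_protected :: "nat \<Rightarrow> plane_tree \<Rightarrow> nat" where
  "num_protected k t = card {v \<in> vertices t. k_protected k t v}"

lemma num_protected_Node:
  "num_protected k (Node ts) =
     of_bool (k_protected k (Node ts) []) + sum_list (map (num_protected k) ts)"
proof -
  let ?R = "{v :: nat list. v = [] \<and> k_protected k (Node ts) []}"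
  let ?S = "\<lambda>i. Cons i ` {v \<in> vertices (ts ! i). k_protected k (ts ! i) v}"
  have fin: "finite (?S i)" for i by (simp add: finite_vertices)
  have "{v \<in> vertices (Node ts). k_protected k (Node ts) v} = ?R \<union> (\<Union>i<length ts. ?S i)"
    by (auto simp: vertices_Node)
  then have "num_protected k (Node ts) = card (?R \<union> (\<Union>i<length ts. ?S i))"
    by (simp only: num_protected_def)
  also have "\<dots> = card ?R + card (\<Union>i<length ts. ?S i)"
    using fin by (intro card_Un_disjoint) auto
  also have "card (\<Union>i<length ts. ?S i) = (\<Sum>i<length ts. card (?S i))"
    by (rule card_UN_disjoint) (use fin in auto)
  also have "\<dots> = sum_list (map (num_protected k) ts)"
    by (simp add: sum_list_sum_nth atLeast0LessThan card_image num_protected_def)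
  also have "card ?R = of_bool (k_protected k (Node ts) [])" by simp
  finally show ?thesis .
qed

lemma num_protected_0: "num_protected 0 t = tree_size t"
  by (simp add: num_protected_def tree_size_def)

lemma card_protected_pairs:
  "card {(t, v). t \<in> trees_of_size n \<and> v \<in> vertices t \<and> k_protected k t v} =
     (\<Sum>t\<in>trees_of_size n. num_protected k t)"
proof -
  have "{(t, v). t \<in> trees_of_size n \<and> v \<in> vertices t \<and> k_protected k t v} =
      Sigma (trees_of_size n) (\<lambda>t. {v \<in> vertices t. k_protected k t v})" by auto
  then show ?thesis
    by (simp add: finite_trees_of_size finite_vertices num_protected_def)
qed

section \<open>Weighted generating functions of trees and forests\<close>

lemma tree_size_pos: "0 < tree_size t"
  by (cases t) (simp add: tree_size_Node)

definition forests_of_size :: "nat \<Rightarrow> plane_tree list set" where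
  "forests_of_size n = {ts. sum_list (map tree_size ts) = n}"

lemma trees_of_size_0 [simp]: "trees_of_size 0 = {}"
  by (simp add: trees_of_size_def tree_size_pos)

lemma trees_of_size_Suc: "trees_of_size (Suc n) = Node ` forests_of_size n"
proof -
  have "t \<in> Node ` forests_of_size n" if "tree_size t = Suc n" for t
    using that by (cases t) (auto simp: forests_of_size_def tree_size_Node)
  then show ?thesis
    by (auto simp: trees_of_size_def forests_of_size_def tree_size_Node)
qed

lemma finite_forests_of_size: "finite (forests_of_size n)"
  using finite_trees_of_size[of "Suc n"] unfolding trees_of_size_Suc
  by (rule finite_imageD) (simp add: inj_on_def)

text \<open>Splitting off the first tree, indexed by its size \<open>i\<close>, gives the index
  pattern of a Cauchy product; \<open>i = 0\<close> contributes nothing.\<close>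

lemma forests_of_size_decomp:
  "{ts \<in> forests_of_size n. ts \<noteq> []} =
     (\<Union>i\<le>n. (\<lambda>(t, ts). t # ts) ` (trees_of_size i \<times> forests_of_size (n - i)))" (is "?L = ?R")
proof (rule set_eqI)
  fix us
  show "us \<in> ?L \<longleftrightarrow> us \<in> ?R"
  proof (cases us)
    case (Cons t ts)
    then show ?thesis
      by (auto simp: forests_of_size_def trees_of_size_def image_iff)
  qed auto
qed

definition tree_gf :: "(plane_tree \<Rightarrow> real) \<Rightarrow> real fps" where
  "tree_gf f = Abs_fps (\<lambda>n. \<Sum>t\<in>trees_of_size n. f t)"

definition forest_gf :: "(plane_tree list \<Rightarrow> real) \<Rightarrow> real fps" where
  "forest_gf h = Abs_fps (\<lambda>n. \<Sum>ts\<in>forests_of_size n. h ts)"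

lemma tree_gf_nth: "fps_nth (tree_gf f) n = (\<Sum>t\<in>trees_of_size n. f t)"
  by (simp add: tree_gf_def)

lemma forest_gf_nth: "fps_nth (forest_gf h) n = (\<Sum>ts\<in>forests_of_size n. h ts)"
  by (simp add: forest_gf_def)

lemma tree_gf_nth_0 [simp]: "fps_nth (tree_gf f) 0 = 0"
  by (simp add: tree_gf_nth)

lemma forest_gf_add: "forest_gf (\<lambda>ts. f ts + g ts) = forest_gf f + forest_gf g"
  by (rule fps_ext) (simp add: forest_gf_nth sum.distrib)

lemma tree_gf_eq_forest_gf: "tree_gf f = fps_X * forest_gf (\<lambda>ts. f (Node ts))"
proof (rule fps_ext)
  fix n
  show "fps_nth (tree_gf f) n = fps_nth (fps_X * forest_gf (\<lambda>ts. f (Node ts))) n"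
    by (cases n) (simp_all add: tree_gf_nth forest_gf_nth trees_of_size_Suc sum.reindex inj_on_def)
qed

lemma forest_gf_single_Nil: "forest_gf (\<lambda>ts. c * of_bool (ts = [])) = fps_const c"
proof (rule fps_ext)
  fix n
  have "(\<Sum>ts\<in>forests_of_size n. c * of_bool (ts = [])) =
      (\<Sum>ts\<in>forests_of_size n. if ts = [] then c else 0)"
    by (rule sum.cong) auto
  also have "\<dots> = (if [] \<in> forests_of_size n then c else 0)"
    by (simp add: finite_forests_of_size)
  finally show "fps_nth (forest_gf (\<lambda>ts. c * of_bool (ts = []))) n = fps_nth (fps_const c) n"
    by (auto simp: forest_gf_nth forests_of_size_def)
qed

text \<open>Size is additive and \<open>h\<close> multiplicative when the first tree is split off.
  The decomposition misses the empty forest, hence \<open>h [] = 0\<close>.\<close>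

lemma forest_gf_product:
  assumes Nil: "h [] = 0" and Cons: "\<And>t ts. h (t # ts) = f t * g ts"
  shows "forest_gf h = tree_gf f * forest_gf g"
proof (rule fps_ext)
  fix n
  let ?P = "\<lambda>i. trees_of_size i \<times> forests_of_size (n - i)"
  let ?c = "\<lambda>(t, ts). t # ts"
  have fin: "finite (?P i)" for i
    by (simp add: finite_trees_of_size finite_forests_of_size)
  have inj: "inj_on ?c A" for A :: "(plane_tree \<times> plane_tree list) set"
    by (auto simp: inj_on_def)
  have "(\<Sum>ts\<in>forests_of_size n. h ts) = (\<Sum>ts\<in>{ts \<in> forests_of_size n. ts \<noteq> []}. h ts)"
    by (rule sum.mono_neutral_right) (auto simp: finite_forests_of_size Nil)
  also have "\<dots> = (\<Sum>i\<le>n. \<Sum>ts\<in>?c ` ?P i. h ts)"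
    unfolding forests_of_size_decomp
  proof (rule sum.UNION_disjoint)
    show "\<forall>i\<in>{..n}. finite (?c ` ?P i)" using fin by blast
    show "\<forall>i\<in>{..n}. \<forall>j\<in>{..n}. i \<noteq> j \<longrightarrow> ?c ` ?P i \<inter> ?c ` ?P j = {}"
      by (auto simp: trees_of_size_def)
  qed simp
  also have "\<dots> = (\<Sum>i\<le>n. \<Sum>(t, ts)\<in>?P i. f t * g ts)"
    by (intro sum.cong refl) (subst sum.reindex[OF inj], auto simp: Cons intro!: sum.cong)
  also have "\<dots> = (\<Sum>i\<le>n. (\<Sum>t\<in>trees_of_size i. f t) * (\<Sum>ts\<in>forests_of_size (n - i). g ts))"
    by (simp add: sum_product sum.cartesian_product)
  finally show "fps_nth (forest_gf h) n = fps_nth (tree_gf f * forest_gf g) n"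
    by (simp add: fps_mult_nth tree_gf_nth forest_gf_nth atLeast0AtMost)
qed

lemma forest_gf_Cons:
  assumes Cons: "\<And>t ts. h (t # ts) = f t * g ts"
  shows "forest_gf h = fps_const (h []) + tree_gf f * forest_gf g"
proof -
  let ?h = "\<lambda>ts. h ts * of_bool (ts \<noteq> [])"
  have "forest_gf h = forest_gf (\<lambda>ts. h [] * of_bool (ts = []) + ?h ts)"
    by (intro arg_cong[where f = forest_gf] ext) auto
  also have "\<dots> = fps_const (h []) + forest_gf ?h"
    by (simp only: forest_gf_add forest_gf_single_Nil)
  also have "forest_gf ?h = tree_gf f * forest_gf g"
    by (rule forest_gf_product) (auto simp: Cons)
  finally show ?thesis .
qed

section \<open>Functional equations for trees, forests and marked vertices\<close>

abbreviation all_trees_gf :: "real fps" where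
  "all_trees_gf \<equiv> tree_gf (\<lambda>_. 1)"

abbreviation all_forests_gf :: "real fps" where
  "all_forests_gf \<equiv> forest_gf (\<lambda>_. 1)"

abbreviation protected_trees_gf :: "nat \<Rightarrow> real fps" where
  "protected_trees_gf k \<equiv> tree_gf (\<lambda>t. of_bool (k_protected k t []))"

abbreviation protected_forests_gf :: "nat \<Rightarrow> real fps" where
  "protected_forests_gf k \<equiv> forest_gf (\<lambda>ts. of_bool (\<forall>t\<in>set ts. k_protected k t []))"

abbreviation protected_vertices_gf :: "nat \<Rightarrow> real fps" where
  "protected_vertices_gf k \<equiv> tree_gf (\<lambda>t. real (num_protected k t))"

lemma all_trees_gf_eq: "all_trees_gf = fps_X * all_forests_gf"
  by (rule tree_gf_eq_forest_gf)

lemma all_forests_gf_eq: "all_forests_gf = 1 + all_trees_gf * all_forests_gf"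
  by (subst forest_gf_Cons[where f = "\<lambda>_. 1" and g = "\<lambda>_. 1"]) auto

lemma protected_trees_gf_0: "protected_trees_gf 0 = all_trees_gf"
  by simp

lemma protected_forests_gf_eq:
  "protected_forests_gf k = 1 + protected_trees_gf k * protected_forests_gf k"
  by (subst forest_gf_Cons[where f = "\<lambda>t. of_bool (k_protected k t [])"
        and g = "\<lambda>ts. of_bool (\<forall>t\<in>set ts. k_protected k t [])"]) auto

text \<open>\<open>fps_X\<close> counts the root. Subtracting \<open>1\<close> discards the empty
  forest, for which the root would itself be a leaf.\<close>

lemma protected_trees_gf_Suc:
  "protected_trees_gf (Suc k) = fps_X * (protected_forests_gf k - 1)"
proof -
  have "protected_forests_gf k = forest_gf (\<lambda>ts. 1 * of_bool (ts = []) +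
      of_bool (k_protected (Suc k) (Node ts) []))"
    by (intro arg_cong[where f = forest_gf] ext) (auto simp: k_protected_Suc_root)
  also have "\<dots> = 1 + forest_gf (\<lambda>ts. of_bool (k_protected (Suc k) (Node ts) []))"
    by (simp only: forest_gf_add forest_gf_single_Nil fps_const_1_eq_1)
  finally show ?thesis
    by (simp add: tree_gf_eq_forest_gf)
qed

text \<open>A protected vertex is the root or lies in one child's subtree. Splitting the sum over
  the children into head and tail gives a linear equation for the forest series, solved using C(1 -
  G) = 1 and G = XC.\<close>

lemma protected_vertices_gf_eq:
  "protected_vertices_gf k * (1 - all_trees_gf * all_forests_gf) = protected_trees_gf k"
proof -
  let ?V = "protected_vertices_gf k" and ?G = all_trees_gf and ?C = all_forests_gf
  let ?s = "\<lambda>ts. real (sum_list (map (num_protected k) ts))"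
  \<comment> \<open>The indicator makes \<open>?a\<close> and \<open>?b\<close> vanish at
    \<open>[]\<close>, as \<open>forest_gf_product\<close> demands, and neutralises the unspecified
    \<open>hd []\<close>.\<close>
  let ?a = "\<lambda>ts. of_bool (ts \<noteq> []) * real (num_protected k (hd ts))"
  let ?b = "\<lambda>ts. of_bool (ts \<noteq> []) * ?s (tl ts)"
  have "forest_gf ?s = forest_gf (\<lambda>ts. ?a ts + ?b ts)"
  proof (intro arg_cong[where f = forest_gf] ext)
    fix ts show "?s ts = ?a ts + ?b ts" by (cases ts) auto
  qed
  also have "\<dots> = forest_gf ?a + forest_gf ?b"
    by (rule forest_gf_add)
  also have "forest_gf ?a = ?V * ?C"
    by (rule forest_gf_product) auto
  also have "forest_gf ?b = ?G * forest_gf ?s"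
    by (rule forest_gf_product) auto
  finally have S: "forest_gf ?s = ?V * ?C + ?G * forest_gf ?s" .
  have V: "?V = protected_trees_gf k + fps_X * forest_gf ?s"
    unfolding tree_gf_eq_forest_gf num_protected_Node
    by (simp add: forest_gf_add distrib_left)
  have C: "?C = 1 + ?G * ?C" by (rule all_forests_gf_eq)
  have "forest_gf ?s = ?V * ?C * ?C"
    using S C by algebra
  then have "fps_X * forest_gf ?s = ?V * ?G * ?C"
    using all_trees_gf_eq by (simp add: mult_ac)
  with V show ?thesis by (simp add: algebra_simps)
qed

section \<open>The derivative of the tree series\<close>

abbreviation central_binomial_gf :: "real fps" where
  "central_binomial_gf \<equiv> fps_deriv all_trees_gf"

lemma all_trees_gf_quadratic: "all_trees_gf = fps_X + all_trees_gf ^ 2"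
proof -
  have "all_trees_gf = fps_X * (1 + all_trees_gf * all_forests_gf)"
    using all_trees_gf_eq all_forests_gf_eq by simp
  also have "\<dots> = fps_X + all_trees_gf * (fps_X * all_forests_gf)"
    by (simp add: algebra_simps)
  also have "\<dots> = fps_X + all_trees_gf ^ 2"
    by (simp only: all_trees_gf_eq[symmetric] power2_eq_square)
  finally show ?thesis .
qed

lemma central_binomial_gf_inverse: "central_binomial_gf * (1 - 2 * all_trees_gf) = 1"
proof -
  have "fps_deriv all_trees_gf = fps_deriv (fps_X + all_trees_gf * all_trees_gf)"
    using all_trees_gf_quadratic by (simp add: power2_eq_square)
  then show ?thesis by (simp add: algebra_simps)
qed

text \<open>This is the differential equation (1 - 4X)B' = 2B of B = 1/sqrt(1 - 4X), obtained
  without square roots; it yields a first-order recurrence for the coefficients.\<close>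

lemma central_binomial_gf_deriv:
  "fps_deriv central_binomial_gf = 4 * fps_X * fps_deriv central_binomial_gf + 2 * central_binomial_gf"
proof -
  let ?B = central_binomial_gf and ?G = all_trees_gf
  have "fps_deriv (?B * (1 - 2 * ?G)) = 0"
    by (simp only: central_binomial_gf_inverse fps_deriv_1)
  then have "fps_deriv ?B * (1 - 2 * ?G) = 2 * ?B * ?B"
    by (simp add: algebra_simps)
  \<comment> \<open>A second factor 1 - 2G turns the left side into a multiple of (1 - 2G)^2 = 1 -
    4X and cancels one B on the right.\<close>
  then have "fps_deriv ?B * (1 - 2 * ?G)\<^sup>2 = 2 * ?B * (?B * (1 - 2 * ?G))"
    by (simp add: power2_eq_square mult_ac)
  also have "(1 - 2 * ?G)\<^sup>2 = 1 - 4 * (?G - ?G\<^sup>2)"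
    by (simp add: power2_eq_square algebra_simps)
  also have "?G - ?G\<^sup>2 = fps_X"
    using all_trees_gf_quadratic by (metis add_diff_cancel_right')
  finally show ?thesis
    unfolding central_binomial_gf_inverse by (simp add: algebra_simps)
qed

text \<open>The series 1 - GC of \<open>protected_vertices_gf_eq\<close> has inverse (1 + B)/2,
  since (1 - G)(1 - GC) = 1 - 2G and 1 + B = 2B(1 - G).\<close>

lemma protected_vertices_gf_product:
  "2 * protected_vertices_gf k = protected_trees_gf k * (1 + central_binomial_gf)"
proof -
  let ?B = central_binomial_gf and ?G = all_trees_gf and ?C = all_forests_gf
  have C: "?G * ?C = ?C - 1"
    using all_forests_gf_eq by (metis add_diff_cancel_left')
  have "(1 - ?G) * (1 - ?G * ?C) = 1 - ?G - ?G * ?C + ?G * (?G * ?C)"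
    by (simp add: algebra_simps)
  also have "\<dots> = 1 - 2 * ?G"
    unfolding C by (simp add: right_diff_distrib C)
  finally have D: "(1 - ?G) * (1 - ?G * ?C) = 1 - 2 * ?G" .
  have "1 + ?B = ?B * (1 - 2 * ?G) + ?B"
    by (simp only: central_binomial_gf_inverse)
  also have "\<dots> = 2 * ?B * (1 - ?G)"
    by (simp add: algebra_simps)
  finally have "(1 + ?B) * (1 - ?G * ?C) = 2 * ?B * ((1 - ?G) * (1 - ?G * ?C))"
    by (simp only: mult.assoc)
  also have "\<dots> = 2"
    unfolding D mult.assoc central_binomial_gf_inverse by simp
  finally have "protected_vertices_gf k * ((1 + ?B) * (1 - ?G * ?C)) = protected_vertices_gf k * 2"
    by (simp only:)
  then show ?thesis
    unfolding protected_vertices_gf_eq[of k, symmetric] by (simp only: mult_ac)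
qed

section \<open>Coefficient asymptotics\<close>

definition central_coeff :: "nat \<Rightarrow> real" where
  "central_coeff n = fps_nth central_binomial_gf n"

lemma central_coeff_Suc:
  "central_coeff (Suc n) = central_coeff n * (4 * (2 * real n + 1) / (2 * real n + 2))"
proof -
  have "fps_nth (fps_deriv central_binomial_gf) n =
      fps_nth (4 * fps_X * fps_deriv central_binomial_gf + 2 * central_binomial_gf) n"
    by (simp only: central_binomial_gf_deriv[symmetric])
  then have "real (Suc n) * central_coeff (Suc n) = 4 * real n * central_coeff n + 2 * central_coeff n"
    unfolding central_coeff_def
    by (cases n) (simp_all add: numeral_fps_const mult.assoc del: fps_deriv_nth
        add: fps_deriv_nth[of central_binomial_gf])
  then show ?thesis by (simp add: field_simps)
qed

lemma central_coeff_0: "central_coeff 0 = 1"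
proof -
  have "fps_nth (central_binomial_gf * (1 - 2 * all_trees_gf)) 0 = 1"
    by (simp only: central_binomial_gf_inverse fps_one_nth) simp
  then show ?thesis by (simp add: central_coeff_def)
qed

lemma central_coeff_pos: "0 < central_coeff n"
  by (induction n) (simp_all add: central_coeff_0 central_coeff_Suc)

lemma all_trees_gf_Suc: "fps_nth all_trees_gf (Suc n) = central_coeff n / real (Suc n)"
  by (simp add: central_coeff_def)

lemma central_coeff_ratio: "(\<lambda>n. central_coeff n / central_coeff (n + j)) \<longlonglongrightarrow> (1/4) ^ j"
proof (induction j)
  case 0
  show ?case using central_coeff_pos by (simp add: less_imp_neq[symmetric])
next
  case (Suc j)
  have step: "(\<lambda>n. (2 * real n + 2) / (4 * (2 * real n + 1))) \<longlonglongrightarrow> 1/4"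
    by real_asymp
  have "(\<lambda>n. (2 * real (n + j) + 2) / (4 * (2 * real (n + j) + 1))) \<longlonglongrightarrow> 1/4"
    by (rule LIMSEQ_ignore_initial_segment[OF step])
  from tendsto_mult[OF Suc this]
  show ?case
    by (simp add: central_coeff_Suc)
qed

lemma central_coeff_scaled_Suc:
  "central_coeff (Suc n) / 4 ^ Suc n =
     central_coeff n / 4 ^ n * ((2 * real n + 1) / (2 * real n + 2))"
proof -
  have "c * (4 * a / b) / (4 * p) = c / p * (a / b)" for c a b p :: real
    by simp
  then show ?thesis
    unfolding central_coeff_Suc power_Suc .
qed

lemma central_coeff_scaled_tendsto_0: "(\<lambda>n. central_coeff n / 4 ^ n) \<longlonglongrightarrow> 0"
proof -
  \<comment> \<open>Squaring makes the induction close: it reduces to (2n + 1)(2n + 3) \<le> (2n +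
    2)^2.\<close>
  have bound: "(central_coeff n / 4 ^ n)\<^sup>2 \<le> 1 / (2 * real n + 1)" for n
  proof (induction n)
    case (Suc n)
    let ?q = "(2 * real n + 1) / (2 * real n + 2)"
    have "(central_coeff (Suc n) / 4 ^ Suc n)\<^sup>2 = (central_coeff n / 4 ^ n)\<^sup>2 * ?q\<^sup>2"
      by (simp only: central_coeff_scaled_Suc power_mult_distrib)
    also have "\<dots> \<le> 1 / (2 * real n + 1) * ?q\<^sup>2"
      by (intro mult_right_mono Suc) simp
    also have "\<dots> \<le> 1 / (2 * real (Suc n) + 1)"
      by (simp add: divide_simps power2_eq_square) (simp add: algebra_simps)
    finally show ?case .
  qed (simp add: central_coeff_0)
  have "(\<lambda>n. (central_coeff n / 4 ^ n)\<^sup>2) \<longlonglongrightarrow> 0"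
  proof (rule tendsto_sandwich[OF _ _ tendsto_const])
    show "(\<lambda>n. 1 / (2 * real n + 1)) \<longlonglongrightarrow> 0" by real_asymp
  qed (use bound in auto)
  then show ?thesis by (simp add: power_tendsto_0_iff)
qed

text \<open>The series telescopes: its term at n + 1 is half the drop from
  \<open>central_coeff n / 4 ^ n\<close> to the next scaled coefficient.\<close>

lemma all_trees_gf_sums: "(\<lambda>n. fps_nth all_trees_gf n * (1/4) ^ n) sums (1/2)"
proof -
  have "(\<lambda>n. central_coeff n / 4 ^ n - central_coeff (Suc n) / 4 ^ Suc n) sums
      (central_coeff 0 / 4 ^ 0 - 0)"
    by (rule telescope_sums'[OF central_coeff_scaled_tendsto_0])
  then have "(\<lambda>n. (central_coeff n / 4 ^ n - central_coeff (Suc n) / 4 ^ Suc n) / 2) sums (1 / 2)"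
    using sums_divide[of _ "1::real" 2] by (simp add: central_coeff_0)
  also have "(\<lambda>n. (central_coeff n / 4 ^ n - central_coeff (Suc n) / 4 ^ Suc n) / 2) =
      (\<lambda>n. fps_nth all_trees_gf (Suc n) * (1/4) ^ Suc n)"
  proof
    fix n
    have diff: "x - x * ((2 * real n + 1) / (2 * real n + 2)) = x / (2 * real n + 2)" for x :: real
      by (simp add: field_simps)
    show "(central_coeff n / 4 ^ n - central_coeff (Suc n) / 4 ^ Suc n) / 2 =
        fps_nth all_trees_gf (Suc n) * (1/4) ^ Suc n"
      unfolding all_trees_gf_Suc central_coeff_scaled_Suc diff by (simp add: power_divide field_simps)
  qed
  finally show ?thesis
    by (subst (asm) sums_Suc_iff) simp
qed

section \<open>Evaluation at the singularity\<close>

lemma tree_gf_mono: "(\<And>t. f t \<le> g t) \<Longrightarrow> fps_nth (tree_gf f) n \<le> fps_nth (tree_gf g) n"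
  by (simp add: tree_gf_nth sum_mono)

lemma forest_gf_mono: "(\<And>ts. f ts \<le> g ts) \<Longrightarrow> fps_nth (forest_gf f) n \<le> fps_nth (forest_gf g) n"
  by (simp add: forest_gf_nth sum_mono)

lemma protected_trees_gf_nonneg: "0 \<le> fps_nth (protected_trees_gf k) n"
  by (simp add: tree_gf_nth sum_nonneg)

lemma protected_forests_gf_nonneg: "0 \<le> fps_nth (protected_forests_gf k) n"
  by (simp add: forest_gf_nth sum_nonneg)

text \<open>Domination by all forests, whose series at 1/4 is four times the shifted tree series
  because G = XC.\<close>

lemma summable_protected_forests_gf:
  "summable (\<lambda>n. fps_nth (protected_forests_gf k) n * (1/4) ^ n)"
proof (rule summable_comparison_test')
  have "summable (\<lambda>n. fps_nth all_trees_gf (Suc n) * (1/4) ^ Suc n)"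
    using all_trees_gf_sums by (subst summable_Suc_iff) (rule sums_summable)
  then have "summable (\<lambda>n. 4 * (fps_nth all_trees_gf (Suc n) * (1/4) ^ Suc n))"
    by (rule summable_mult)
  also have "(\<lambda>n. 4 * (fps_nth all_trees_gf (Suc n) * (1/4) ^ Suc n)) =
      (\<lambda>n. fps_nth all_forests_gf n * (1/4) ^ n)"
    by (subst all_trees_gf_eq) simp
  finally show "summable (\<lambda>n. fps_nth all_forests_gf n * (1/4) ^ n)" .
  show "norm (fps_nth (protected_forests_gf k) n * (1/4) ^ n) \<le>
      fps_nth all_forests_gf n * (1/4) ^ n" if "n \<ge> 0" for n
    using protected_forests_gf_nonneg[of k n] by (auto simp: abs_mult intro!: forest_gf_mono)
qed

text \<open>Nonnegative terms make convergence absolute, so the Cauchy product applies even at the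
  singularity.\<close>

lemma sums_fps_mult:
  fixes A B :: "real fps"
  assumes A: "(\<lambda>n. fps_nth A n * x ^ n) sums a" "\<And>n. 0 \<le> fps_nth A n"
    and B: "(\<lambda>n. fps_nth B n * x ^ n) sums b" "\<And>n. 0 \<le> fps_nth B n"
    and x: "0 \<le> x"
  shows "(\<lambda>n. fps_nth (A * B) n * x ^ n) sums (a * b)"
proof -
  have "(\<lambda>n. \<Sum>i\<le>n. (fps_nth A i * x ^ i) * (fps_nth B (n - i) * x ^ (n - i))) sums
      ((\<Sum>n. fps_nth A n * x ^ n) * (\<Sum>n. fps_nth B n * x ^ n))"
    using assms by (intro Cauchy_product_sums) (auto simp: abs_mult sums_iff)
  also have "(\<lambda>n. \<Sum>i\<le>n. (fps_nth A i * x ^ i) * (fps_nth B (n - i) * x ^ (n - i))) =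
      (\<lambda>n. fps_nth (A * B) n * x ^ n)"
    by (auto simp: fps_mult_nth sum_distrib_right atLeast0AtMost fun_eq_iff simp flip: power_add
        intro!: sum.cong)
  finally show ?thesis using A B by (simp add: sums_iff)
qed

lemma protected_trees_gf_sums:
  "(\<lambda>n. fps_nth (protected_trees_gf k) n * (1/4) ^ n) sums (3 / (2 * (4 ^ k + 2)))"
proof (induction k)
  case 0
  show ?case unfolding protected_trees_gf_0 using all_trees_gf_sums by simp
next
  case (Suc k)
  let ?F = "protected_forests_gf k" and ?A = "protected_trees_gf k"
  let ?a = "3 / (2 * (4 ^ k + 2)) :: real"
  \<comment> \<open>Once the sum is known to exist, evaluating the functional equation of
    \<open>?F\<close> at 1/4 determines \<phi>.\<close>
  obtain \<phi> where \<phi>: "(\<lambda>n. fps_nth ?F n * (1/4) ^ n) sums \<phi>"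
    using summable_protected_forests_gf by (auto simp: summable_def)
  have one: "(\<lambda>n. fps_nth 1 n * (1/4) ^ n) sums (1::real)"
    using powser_sums_if[of 0 "1/4 :: real"] by (simp add: if_distrib if_distribR cong: if_cong)
  have "(\<lambda>n. fps_nth (?A * ?F) n * (1/4) ^ n) sums (?a * \<phi>)"
    by (rule sums_fps_mult[OF Suc _ \<phi>])
      (simp_all add: protected_trees_gf_nonneg protected_forests_gf_nonneg)
  from sums_add[OF one this]
  have "(\<lambda>n. fps_nth (1 + ?A * ?F) n * (1/4) ^ n) sums (1 + ?a * \<phi>)"
    by (simp only: fps_add_nth distrib_right)
  then have "(\<lambda>n. fps_nth ?F n * (1/4) ^ n) sums (1 + ?a * \<phi>)"
    by (simp only: protected_forests_gf_eq[symmetric])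
  with \<phi> have eq: "\<phi> = 1 + ?a * \<phi>"
    by (rule sums_unique2)
  have pos: "(4::real) ^ k > 0" by simp
  have \<phi>_eq: "(\<phi> - 1) / 4 = 3 / (2 * (4 ^ Suc k + 2))"
  proof -
    have "\<phi> * (2 * 4 ^ k + 1) = 2 * 4 ^ k + 4"
      using eq pos by (simp add: field_simps)
    then have "(\<phi> - 1) * (2 * 4 ^ k + 1) = 3"
      by (simp add: algebra_simps)
    moreover have "2 * 4 ^ k + 1 \<noteq> (0::real)"
      using pos by linarith
    ultimately have "\<phi> - 1 = 3 / (2 * 4 ^ k + 1)"
      by (simp only: eq_divide_eq) simp
    then show ?thesis by simp
  qed
  from sums_diff[OF \<phi> one] have "(\<lambda>n. fps_nth (?F - 1) n * (1/4) ^ n) sums (\<phi> - 1)"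
    by (simp only: fps_sub_nth left_diff_distrib)
  then have "(\<lambda>n. fps_nth (?F - 1) n * (1/4) ^ n / 4) sums ((\<phi> - 1) / 4)"
    by (rule sums_divide)
  \<comment> \<open>The division by 4 is the value of \<open>fps_X\<close> at 1/4. The shift loses
    only the zero constant term.\<close>
  also have "(\<lambda>n. fps_nth (?F - 1) n * (1/4) ^ n / 4) =
      (\<lambda>n. fps_nth (protected_trees_gf (Suc k)) (Suc n) * (1/4) ^ Suc n)"
    unfolding protected_trees_gf_Suc by simp
  finally show ?case
    unfolding \<phi>_eq by (subst (asm) sums_Suc_iff) simp
qed

section \<open>The limit\<close>

text \<open>The Fatou half: a finite partial sum of the limits already exceeds \<open>c\<close>,
  finitely many terms converge together, and the remaining terms are nonnegative.\<close>

lemma eventually_weighted_sum_gt: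
  fixes u :: "nat \<Rightarrow> real"
  assumes u: "\<And>i. 0 \<le> u i" and w: "\<And>n i. 0 \<le> w n i"
    and lim: "\<And>i. (\<lambda>n. u i * w n i) \<longlonglongrightarrow> \<omega> i"
    and s: "\<omega> sums s" and c: "c < s"
  shows "eventually (\<lambda>n. c < (\<Sum>i\<le>n. u i * w n i)) sequentially"
proof -
  from order_tendstoD(1)[OF s[unfolded sums_def] c]
  obtain M where M: "c < (\<Sum>i<M. \<omega> i)"
    by (auto simp: eventually_sequentially)
  have "(\<lambda>n. \<Sum>i<M. u i * w n i) \<longlonglongrightarrow> (\<Sum>i<M. \<omega> i)"
    by (intro tendsto_sum lim)
  from order_tendstoD(1)[OF this M] eventually_ge_at_top[of M]
  show ?thesis
  proof eventually_elim
    case (elim n)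
    have "(\<Sum>i<M. u i * w n i) \<le> (\<Sum>i\<le>n. u i * w n i)"
      by (rule sum_mono2) (use elim u w in auto)
    with elim show ?case by simp
  qed
qed

text \<open>
  A form of Scheffe's lemma: no mass escapes since the total is \<open>1\<close> before and after the limit,
  so no uniform bound on the weights is needed.
\<close>
lemma weighted_sum_tendsto:
  fixes u v :: "nat \<Rightarrow> real"
  assumes u: "\<And>i. 0 \<le> u i" "\<And>i. u i \<le> v i" and w: "\<And>n i. 0 \<le> w n i"
    and lim: "\<And>i. (\<lambda>n. v i * w n i) \<longlonglongrightarrow> v i * \<omega> i"
    and s: "(\<lambda>i. u i * \<omega> i) sums s" and tot: "(\<lambda>i. v i * \<omega> i) sums 1"
    and one: "eventually (\<lambda>n. (\<Sum>i\<le>n. v i * w n i) = 1) sequentially"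
  shows "(\<lambda>n. \<Sum>i\<le>n. u i * w n i) \<longlonglongrightarrow> s"
proof -
  \<comment> \<open>Where \<open>v i = 0\<close> the bounds force \<open>a = 0\<close>, so
    convergence of \<open>w\<close> itself is not assumed.\<close>
  have scale: "(\<lambda>n. a * w n i) \<longlonglongrightarrow> a * \<omega> i" if "0 \<le> a" "a \<le> v i" for a i
  proof (cases "v i = 0")
    case False
    then show ?thesis
      using tendsto_mult_left[OF lim[of i], of "a / v i"] by simp
  qed (use that in simp)
  show ?thesis
  proof (rule order_tendstoI)
    fix c assume "c < s"
    then show "eventually (\<lambda>n. c < (\<Sum>i\<le>n. u i * w n i)) sequentially"
      by (intro eventually_weighted_sum_gt[OF u(1) w scale s]) (use u in auto)
  next
    fix c assume c: "s < c"
    \<comment> \<open>The upper bound is the lower bound for the complementary coefficients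
      \<open>v i - u i\<close>, as the total is eventually 1.\<close>
    have "(\<lambda>i. (v i - u i) * \<omega> i) sums (1 - s)"
      using sums_diff[OF tot s] by (simp add: left_diff_distrib)
    then have "eventually (\<lambda>n. 1 - c < (\<Sum>i\<le>n. (v i - u i) * w n i)) sequentially"
      by (intro eventually_weighted_sum_gt[OF _ w scale]) (use u c in auto)
    with one show "eventually (\<lambda>n. (\<Sum>i\<le>n. u i * w n i) < c) sequentially"
      by eventually_elim (simp add: left_diff_distrib sum_subtractf)
  qed
qed

text \<open>For \<open>i \<le> n\<close> this is the coefficient of 1 + B at \<open>n - i\<close>,
  over twice the number of (tree, vertex) pairs of size \<open>n\<close> when
  \<open>n \<ge> 1\<close>. The indicator is the constant term 1, present only at
  \<open>i = n\<close>.\<close>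

definition weight :: "nat \<Rightarrow> nat \<Rightarrow> real" where
  "weight n i = (of_bool (n \<le> i) + central_coeff (n - i)) / (2 * central_coeff (n - 1))"

lemma weight_nonneg: "0 \<le> weight n i"
  by (simp add: weight_def central_coeff_pos less_imp_le)

lemma weight_tendsto: "(\<lambda>n. weight n (Suc j)) \<longlonglongrightarrow> 2 * (1/4) ^ Suc j"
proof (rule LIMSEQ_offset[where k = "Suc j"])
  have "(\<lambda>n. 1/2 * (central_coeff n / central_coeff (n + j))) \<longlonglongrightarrow> 1/2 * (1/4) ^ j"
    by (intro tendsto_intros central_coeff_ratio)
  \<comment> \<open>At \<open>n = 0\<close> the indicator in \<open>weight\<close> would still
    contribute.\<close>
  moreover have "eventually (\<lambda>n. 1/2 * (central_coeff n / central_coeff (n + j)) =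
      weight (n + Suc j) (Suc j)) sequentially"
    using eventually_gt_at_top[of 0]
    by eventually_elim (simp add: weight_def)
  ultimately show "(\<lambda>n. weight (n + Suc j) (Suc j)) \<longlonglongrightarrow> 2 * (1/4) ^ Suc j"
    by (rule Lim_transform_eventually[THEN tendsto_eq_rhs]) simp
qed

text \<open>Marking any vertex multiplies the tree count by \<open>n\<close>, which is
  differentiation with the index shifted by one.\<close>

lemma all_vertices_gf_nth:
  "n \<ge> 1 \<Longrightarrow> fps_nth (protected_vertices_gf 0) n = central_coeff (n - 1)"
proof -
  assume "n \<ge> 1"
  then obtain m where m: "n = Suc m" by (cases n) auto
  have "fps_nth (protected_vertices_gf 0) n = (\<Sum>t\<in>trees_of_size n. real n)"
    unfolding tree_gf_nth num_protected_0 by (intro sum.cong) (auto simp: trees_of_size_def)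
  also have "\<dots> = real n * fps_nth all_trees_gf n" by (simp add: tree_gf_nth)
  finally show ?thesis by (simp add: m all_trees_gf_Suc)
qed

lemma protected_vertices_gf_nth:
  "fps_nth (protected_vertices_gf k) n / central_coeff (n - 1) =
     (\<Sum>i\<le>n. fps_nth (protected_trees_gf k) i * weight n i)"
proof -
  have "2 * fps_nth (protected_vertices_gf k) n = fps_nth (2 * protected_vertices_gf k) n"
    by (simp add: numeral_fps_const)
  also have "\<dots> = (\<Sum>i\<le>n. fps_nth (protected_trees_gf k) i * (of_bool (n \<le> i) + central_coeff (n - i)))"
    unfolding protected_vertices_gf_product fps_mult_nth atLeast0AtMost central_coeff_def
    by (intro sum.cong refl) simp
  finally have "(\<Sum>i\<le>n. fps_nth (protected_trees_gf k) i * (of_bool (n \<le> i) + central_coeff (n - i))) =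
      2 * fps_nth (protected_vertices_gf k) n" ..
  then show ?thesis
    by (simp only: weight_def sum_divide_distrib[symmetric] times_divide_eq_right
        mult_divide_mult_cancel_left_if) simp
qed

lemma protected_prob_eq_weighted_sum:
  assumes "n \<ge> 1"
  shows "protected_prob k n = (\<Sum>i\<le>n. fps_nth (protected_trees_gf k) i * weight n i)"
proof -
  have "protected_prob k n = fps_nth (protected_vertices_gf k) n / fps_nth (protected_vertices_gf 0) n"
    using protected_prob_eq_ratio[OF assms, of k] card_protected_pairs[of n k]
      card_protected_pairs[of n 0] by (simp add: tree_gf_nth)
  then show ?thesis
    using assms by (simp only: all_vertices_gf_nth protected_vertices_gf_nth)
qed

lemma protected_prob_tendsto: "(\<lambda>n. protected_prob k n) \<longlonglongrightarrow> 3 / (4 ^ k + 2)"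
proof -
  let ?u = "fps_nth (protected_trees_gf k)" and ?v = "fps_nth all_trees_gf"
  let ?w = "\<lambda>i. 2 * (1/4) ^ i :: real"
  have "(\<lambda>n. \<Sum>i\<le>n. ?u i * weight n i) \<longlonglongrightarrow> 3 / (4 ^ k + 2)"
  proof (rule weighted_sum_tendsto[where v = ?v and \<omega> = ?w])
    show "(\<lambda>n. ?v i * weight n i) \<longlonglongrightarrow> ?v i * ?w i" for i
    \<comment> \<open>At \<open>i = 0\<close> both sides vanish, as no tree has size 0;
      \<open>weight_tendsto\<close> covers the positive indices.\<close>
    proof (cases i)
      case (Suc j)
      show ?thesis unfolding Suc by (intro tendsto_mult tendsto_const weight_tendsto)
    qed simp
    show "(\<lambda>i. ?u i * ?w i) sums (3 / (4 ^ k + 2))"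
      using sums_mult[OF protected_trees_gf_sums[of k], of 2]
      by (simp only: mult_ac mult_divide_mult_cancel_left times_divide_eq_right)
    show "(\<lambda>i. ?v i * ?w i) sums 1"
      using sums_mult[OF all_trees_gf_sums, of 2] by (simp add: mult_ac)
    \<comment> \<open>This is the case \<open>k = 0\<close>: every vertex is 0-protected, so the
      probability is 1.\<close>
    show "eventually (\<lambda>n. (\<Sum>i\<le>n. ?v i * weight n i) = 1) sequentially"
      using eventually_ge_at_top[of 1]
    proof eventually_elim
      case (elim n)
      then show ?case
        using protected_vertices_gf_nth[of 0 n] central_coeff_pos[of "n - 1"]
        by (simp add: all_vertices_gf_nth)
    qed
  qed (auto intro!: tree_gf_mono simp: protected_trees_gf_nonneg weight_nonneg)
  moreover have "eventually (\<lambda>n. (\<Sum>i\<le>n. ?u i * weight n i) = protected_prob k n) sequentially"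
    using eventually_ge_at_top[of 1] by eventually_elim (rule protected_prob_eq_weighted_sum[symmetric])
  ultimately show ?thesis
    by (rule Lim_transform_eventually)
qed

theorem corollary3p4:
  fixes k :: nat
  shows "(\<lambda>n. protected_prob k n) \<sim>[at_top] (\<lambda>n. 3 / (4 ^ k + 2))"
proof (rule tendsto_imp_asymp_equiv_const[OF protected_prob_tendsto])
  have "(4::real) ^ k + 2 > 0" by (simp add: add_pos_pos)
  then show "3 / (4 ^ k + 2) \<noteq> (0::real)" by simp
qed

end
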